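(* Suppose that $Y_1,\ldots,Y_n$ form a random sample (i.i.d.) from the distribution with probability density function $$f(y\mid\theta)=\begin{cases}\dfrac{\theta}{(1-\theta)(1-y)^2}, & 0\le y\le 1-\theta,\\[2mm] 0,&\text{otherwise,}\end{cases}$$ where $\theta$, $0<\theta<1$, is unknown. Then the maximum likelihood estimator of $\theta$ is $$\hat\theta=1-Y_{(n)},\qquad Y_{(n)}=\max(Y_1,\ldots,Y_n).$$
   Context: The likelihood function is $\ell(\theta)=\left(\frac{\theta}{1-\theta}\right)^n\frac{1}{\prod_{i=1}^n(1-y_i)^2}$ if $0\le y_i\le 1-\theta$ for all $i=1,\ldots,n$, and $\ell(\theta)=0$ otherwise; the maximum likelihood estimator is the value of $\theta$ maximizing $\ell$. *)

theory Defs
  imports "HOL-Probability.Probability"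
begin

definition pdf_Y :: "real \<Rightarrow> real \<Rightarrow> real" where
  "pdf_Y \<theta> y = (if 0 \<le> y \<and> y \<le> 1 - \<theta> then \<theta> / ((1 - \<theta>) * (1 - y)\<^sup>2) else 0)"

definition likelihood :: "(real \<Rightarrow> real \<Rightarrow> real) \<Rightarrow> nat \<Rightarrow> (nat \<Rightarrow> real) \<Rightarrow> real \<Rightarrow> real" where
  "likelihood f n y \<theta> = (\<Prod>i=1..n. f \<theta> (y i))"

lemma likelihood_pdf_Y:
  "likelihood pdf_Y n y \<theta> =
     (if \<forall>i\<in>{1..n}. 0 \<le> y i \<and> y i \<le> 1 - \<theta>
      then (\<theta> / (1 - \<theta>)) ^ n * (1 / (\<Prod>i=1..n. (1 - y i)\<^sup>2)) else 0)"
proof (cases "\<forall>i\<in>{1..n}. 0 \<le> y i \<and> y i \<le> 1 - \<theta>")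
  case True
  then have "likelihood pdf_Y n y \<theta> = (\<Prod>i=1..n. (\<theta> / (1 - \<theta>)) * (1 / (1 - y i)\<^sup>2))"
    unfolding likelihood_def by (intro prod.cong) (auto simp: pdf_Y_def)
  also have "\<dots> = (\<theta> / (1 - \<theta>)) ^ n * (1 / (\<Prod>i=1..n. (1 - y i)\<^sup>2))"
    by (simp add: prod.distrib prod_dividef power_divide)
  finally show ?thesis using True by simp
next
  case False
  then have "\<exists>i\<in>{1..n}. pdf_Y \<theta> (y i) = 0" by (auto simp: pdf_Y_def)
  then have "likelihood pdf_Y n y \<theta> = 0"
    unfolding likelihood_def by (intro prod_zero) auto
  then show ?thesis using False by (simp only: if_False)
qed

text \<open>The maximum likelihood estimate is \<^emph>\<open>the\<close> maximiser, so uniqueness over the parameter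
  space \<open>\<Theta>\<close> is part of the notion.\<close>

definition is_MLE ::
  "(real \<Rightarrow> real \<Rightarrow> real) \<Rightarrow> real set \<Rightarrow> nat \<Rightarrow> (nat \<Rightarrow> real) \<Rightarrow> real \<Rightarrow> bool" where
  "is_MLE f \<Theta> n y t \<longleftrightarrow>
     is_arg_max (likelihood f n y) (\<lambda>\<theta>. \<theta> \<in> \<Theta>) t \<and>
     (\<forall>t'. is_arg_max (likelihood f n y) (\<lambda>\<theta>. \<theta> \<in> \<Theta>) t' \<longrightarrow> t' = t)"

end

(* On the parameter space, the likelihood is strictly increasing in \<theta> up to 1 - y_(n), because
   \<theta>/(1 - \<theta>) is, and vanishes beyond that point. The sample almost surely has all its
   entries in (0, 1 - \<theta>]; the entry 0 is excluded because an all-zero sample would put the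
   maximiser at 1, outside the open parameter space. *)
theory Submission
  imports Defs
begin

text \<open>One strict inequality gives both halves of \<open>is_MLE\<close>: by asymmetry of
  \<open><\<close> no competitor beats \<open>t\<close>, and any other maximiser would be beaten by
  \<open>t\<close>.\<close>

lemma is_MLE_if_strict_max:
  assumes "t \<in> \<Theta>"
    and less: "\<And>t'. t' \<in> \<Theta> \<Longrightarrow> t' \<noteq> t \<Longrightarrow> likelihood f n y t' < likelihood f n y t"
  shows "is_MLE f \<Theta> n y t"
proof -
  have "is_arg_max (likelihood f n y) (\<lambda>\<theta>. \<theta> \<in> \<Theta>) t"
    unfolding is_arg_max_def using assms by (metis less_asym)
  moreover have "t' = t" if "is_arg_max (likelihood f n y) (\<lambda>\<theta>. \<theta> \<in> \<Theta>) t'" for t'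
    using that assms unfolding is_arg_max_def by blast
  ultimately show ?thesis unfolding is_MLE_def by blast
qed

text \<open>The deterministic core. The hypotheses put the sample maximum strictly between 0 and 1,
  so the estimate lies in the open parameter space.\<close>

lemma is_MLE_pdf_Y:
  fixes y :: "nat \<Rightarrow> real"
  assumes y: "\<And>i. i \<in> {1..n} \<Longrightarrow> 0 \<le> y i \<and> y i < 1"
    and nz: "\<exists>i\<in>{1..n}. y i \<noteq> 0"
  shows "is_MLE pdf_Y {0<..<1} n y (1 - Max (y ` {1..n}))"
proof -
  define m where "m = Max (y ` {1..n})"
  obtain j where j: "j \<in> {1..n}" "y j \<noteq> 0" using nz by blast
  then have ne: "y ` {1..n} \<noteq> {}" and "n > 0" by auto
  have ub: "y i \<le> m" if "i \<in> {1..n}" for i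
    unfolding m_def using that by (intro Max_ge) auto
  have "0 < y j" using y[OF j(1)] j(2) by simp
  then have m: "0 < m" using ub[OF j(1)] by linarith
  have m_in: "m \<in> y ` {1..n}" unfolding m_def using ne by (intro Max_in) auto
  then have m1: "m < 1" using y by auto
  \<comment> \<open>The factor of the likelihood free of the parameter; only its positivity matters
    for comparisons.\<close>
  define c where "c = 1 / (\<Prod>i=1..n. (1 - y i)\<^sup>2)"
  have "0 < (\<Prod>i=1..n. (1 - y i)\<^sup>2)"
    using y by (intro prod_pos) (fastforce simp: zero_less_power2)
  then have c: "0 < c" by (simp add: c_def)
  have L: "likelihood pdf_Y n y t = (if t \<le> 1 - m then (t / (1 - t)) ^ n * c else 0)" for t
  proof -
    \<comment> \<open>Since \<open>m\<close> is both an upper bound and an entry of the sample, it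
      alone decides the support condition.\<close>
    have "(\<forall>i\<in>{1..n}. 0 \<le> y i \<and> y i \<le> 1 - t) \<longleftrightarrow> t \<le> 1 - m"
      using y ub m_in by fastforce
    then show ?thesis by (simp only: likelihood_pdf_Y c_def)
  qed
  have "is_MLE pdf_Y {0<..<1} n y (1 - m)"
  proof (rule is_MLE_if_strict_max)
    show "1 - m \<in> {0<..<1}" using m m1 by simp
  next
    fix t assume t: "t \<in> {0<..<1}" "t \<noteq> 1 - m"
    show "likelihood pdf_Y n y t < likelihood pdf_Y n y (1 - m)"
    proof (cases "t \<le> 1 - m")
      case True
      \<comment> \<open>Cross-multiplying and cancelling \<open>t * m\<close> leaves
        \<open>t < 1 - m\<close>.\<close>
      have "t / (1 - t) < (1 - m) / m"
        using True t m by (simp add: divide_simps) (simp add: algebra_simps)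
      moreover have "0 \<le> t / (1 - t)" using t by simp
      ultimately have "(t / (1 - t)) ^ n < ((1 - m) / m) ^ n"
        using \<open>n > 0\<close> by (intro power_strict_mono)
      then show ?thesis using True c by (simp add: L)
    next
      case False
      then show ?thesis using c m m1 by (simp add: L)
    qed
  qed
  then show ?thesis by (simp only: m_def)
qed

lemma AE_distributed_pdf_Y:
  assumes X: "distributed M lborel X (\<lambda>y. ennreal (pdf_Y \<theta> y))"
  shows "AE \<omega> in M. 0 < X \<omega> \<and> X \<omega> \<le> 1 - \<theta>"
proof -
  have [measurable]: "X \<in> measurable M lborel"
    "(\<lambda>y. ennreal (pdf_Y \<theta> y)) \<in> borel_measurable lborel"
    using X by (auto simp: distributed_def)
  \<comment> \<open>The implication can fail only at \<open>x = 0\<close>, a Lebesgue null set. It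
    then passes to the density measure, which is the law of \<open>X\<close>, and is pulled back
    along \<open>X\<close>.\<close>
  have "AE x in lborel. 0 < ennreal (pdf_Y \<theta> x) \<longrightarrow> 0 < x \<and> x \<le> 1 - \<theta>"
    using AE_lborel_singleton[of 0] by eventually_elim (auto simp: pdf_Y_def split: if_splits)
  then have "AE x in density lborel (\<lambda>y. ennreal (pdf_Y \<theta> y)). 0 < x \<and> x \<le> 1 - \<theta>"
    by (subst AE_density) auto
  then have "AE x in distr M lborel X. 0 < x \<and> x \<le> 1 - \<theta>"
    using X unfolding distributed_def by metis
  then show ?thesis by (rule AE_distrD[rotated]) measurable
qed

theorem mainTheorem5:
  fixes M :: "'a measure" and Y :: "nat \<Rightarrow> 'a \<Rightarrow> real" and n :: nat and \<theta> :: real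
  assumes "prob_space M"
    and "n \<ge> 1"
    and "0 < \<theta>" and "\<theta> < 1"
    and "prob_space.indep_vars M (\<lambda>_. borel) Y {1..n}"
    and "\<And>i. i \<in> {1..n} \<Longrightarrow> distributed M lborel (Y i) (\<lambda>y. ennreal (pdf_Y \<theta> y))"
  shows "(AE \<omega> in M. is_MLE pdf_Y {0<..<1} n (\<lambda>i. Y i \<omega>) (1 - Max ((\<lambda>i. Y i \<omega>) ` {1..n}))) \<and>
    (\<forall>y. (\<forall>i\<in>{1..n}. 0 \<le> y i \<and> y i < 1) \<and> (\<exists>i\<in>{1..n}. y i \<noteq> 0) \<longrightarrow>
       is_MLE pdf_Y {0<..<1} n y (1 - Max (y ` {1..n})))"
proof (intro conjI allI impI)
  have "AE \<omega> in M. \<forall>i\<in>{1..n}. 0 < Y i \<omega> \<and> Y i \<omega> \<le> 1 - \<theta>"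
    using assms(6) by (intro AE_finite_allI AE_distributed_pdf_Y) auto
  then show "AE \<omega> in M. is_MLE pdf_Y {0<..<1} n (\<lambda>i. Y i \<omega>) (1 - Max ((\<lambda>i. Y i \<omega>) ` {1..n}))"
  proof eventually_elim
    case (elim \<omega>)
    \<comment> \<open>A nonempty sample with all entries positive has a nonzero entry, witnessed by
      index 1.\<close>
    have "1 \<in> {1..n}" using assms(2) by simp
    then have "\<exists>i\<in>{1..n}. Y i \<omega> \<noteq> 0" using elim by force
    moreover have "0 \<le> Y i \<omega> \<and> Y i \<omega> < 1" if "i \<in> {1..n}" for i
      \<comment> \<open>Positivity of \<open>\<theta>\<close> makes the bound
        \<open>1 - \<theta>\<close> strictly less than 1.\<close>
      using bspec[OF elim that] assms(3) by linarith
    ultimately show ?case by (intro is_MLE_pdf_Y)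
  qed
next
  fix y :: "nat \<Rightarrow> real"
  assume "(\<forall>i\<in>{1..n}. 0 \<le> y i \<and> y i < 1) \<and> (\<exists>i\<in>{1..n}. y i \<noteq> 0)"
  then show "is_MLE pdf_Y {0<..<1} n y (1 - Max (y ` {1..n}))"
    by (intro is_MLE_pdf_Y) auto
qed

end
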